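(* Let $q\in\mathbb{C}$ be nonzero and not a root of unity, and let $\mathcal{W}_q$ be the $q$-deformed $W(2,2)$ algebra, regarded as a Hom-Lie algebra $(\mathcal{W}_q,[\cdot,\cdot]_q,\alpha)$. Then $$H^2(\mathcal{W}_q,\mathbb{C})=\mathbb{C}\beta\oplus\mathbb{C}\gamma,$$ where $\beta,\gamma$ are (the classes of) the skew-symmetric bilinear $2$-cocycles determined, for all $m,n\in\mathbb{Z}$, by $$\beta(L_m,L_n)=\delta_{m,-n}\frac{[m-1]_q[m]_q[m+1]_q}{[2]_q[3]_q\langle m\rangle_q},\qquad \beta(L_m,M_n)=\beta(M_m,M_n)=0,$$ $$\gamma(L_m,M_n)=\delta_{m,-n}\frac{[m-1]_q[m]_q[m+1]_q}{[2]_q[3]_q\langle m\rangle_q},\qquad \gamma(L_m,L_n)=\gamma(M_m,M_n)=0,$$ and $\langle m\rangle_q=q^m+q^{-m}$.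
   Context: All vector spaces and algebras are over $\mathbb{C}$. The $q$-number is $[n]_q=\frac{q^n-q^{-n}}{q-q^{-1}}$. The $q$-deformed $W(2,2)$ algebra $\mathcal{W}_q$ is the vector space with basis $\{L_n,M_n: n\in\mathbb{Z}\}$ and skew-symmetric bilinear bracket $[L_n,L_m]_q=[m-n]_qL_{m+n}$, $[L_n,M_m]_q=[m-n]_qM_{m+n}$, $[M_n,M_m]_q=0$. With the linear map $\alpha(L_n)=(q^n+q^{-n})L_n$, $\alpha(M_n)=(q^n+q^{-n})M_n$ it is a Hom-Lie algebra, i.e. the bracket is skew-symmetric and $[[x,y],\alpha(z)]+[[y,z],\alpha(x)]+[[z,x],\alpha(y)]=0$ for all $x,y,z$. For a Hom-Lie algebra $(\mathcal{L},[\cdot,\cdot],\alpha)$, a $2$-cocycle is a bilinear map $\psi:\mathcal{L}\times\mathcal{L}\to\mathbb{C}$ with $\psi(x,y)=-\psi(y,x)$ and $\psi(\alpha(x),[y,z])+\psi(\alpha(y),[z,x])+\psi(\alpha(z),[x,y])=0$ for all $x,y,z$; $Z^2(\mathcal{L},\mathbb{C})$ is the space of $2$-cocycles. $B^2(\mathcal{L},\mathbb{C})$ is the space of $2$-coboundaries $\psi_f(x,y)=f([x,y])$, $f:\mathcal{L}\to\mathbb{C}$ linear, and $H^2(\mathcal{L},\mathbb{C})=Z^2(\mathcal{L},\mathbb{C})/B^2(\mathcal{L},\mathbb{C})$. *)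

theory Defs
  imports Complex_Main "HOL-Library.Poly_Mapping" "HOL-Library.Function_Algebras"
    "HOL-Library.Set_Algebras"
begin

section \<open>Hom-Lie algebras over the complex numbers and their second cohomology\<close>

definition bilinear_map ::
    "(complex \<Rightarrow> 'a::ab_group_add \<Rightarrow> 'a) \<Rightarrow> (complex \<Rightarrow> 'b::ab_group_add \<Rightarrow> 'b) \<Rightarrow> ('a \<Rightarrow> 'a \<Rightarrow> 'b) \<Rightarrow> bool"
  where "bilinear_map s t b \<longleftrightarrow>
    (\<forall>y. Vector_Spaces.linear s t (\<lambda>x. b x y)) \<and> (\<forall>x. Vector_Spaces.linear s t (b x))"

lemma vector_space_times: "vector_space ((*) :: complex \<Rightarrow> complex \<Rightarrow> complex)"
  by unfold_locales (auto simp: algebra_simps)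

locale hom_lie_algebra = vector_space scale
  for scale :: "complex \<Rightarrow> 'a::ab_group_add \<Rightarrow> 'a" +
  fixes br :: "'a \<Rightarrow> 'a \<Rightarrow> 'a" and \<alpha> :: "'a \<Rightarrow> 'a"
  assumes bilinear_br: "bilinear_map scale scale br"
    and linear_\<alpha>: "Vector_Spaces.linear scale scale \<alpha>"
    and skew_br: "br x y = - br y x"
    and hom_jacobi: "br (br x y) (\<alpha> z) + br (br y z) (\<alpha> x) + br (br z x) (\<alpha> y) = 0"
begin

definition Z2 :: "('a \<Rightarrow> 'a \<Rightarrow> complex) set"
  where "Z2 = {\<psi>. bilinear_map scale (*) \<psi> \<and> (\<forall>x y. \<psi> x y = - \<psi> y x) \<and>
    (\<forall>x y z. \<psi> (\<alpha> x) (br y z) + \<psi> (\<alpha> y) (br z x) + \<psi> (\<alpha> z) (br x y) = 0)}"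

definition B2 :: "('a \<Rightarrow> 'a \<Rightarrow> complex) set"
  where "B2 = {\<lambda>x y. f (br x y) | f. Vector_Spaces.linear scale (*) f}"

text \<open>
  Elements of the quotient \<open>Z2 / B2\<close> are cosets of \<open>B2\<close>.  They are added as sets, and the zero
  of the quotient is \<open>B2\<close> itself.  A coset is scaled by scaling its elements and then adding
  \<open>B2\<close>; adding \<open>B2\<close> matters only for the scalar \<open>0\<close>, where the image alone would be the
  singleton of the zero map.
\<close>

definition H2_class :: "('a \<Rightarrow> 'a \<Rightarrow> complex) \<Rightarrow> ('a \<Rightarrow> 'a \<Rightarrow> complex) set"
  where "H2_class \<psi> = \<psi> +o B2"

definition H2 :: "('a \<Rightarrow> 'a \<Rightarrow> complex) set set"
  where "H2 = H2_class ` Z2"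

definition H2_scale :: "complex \<Rightarrow> ('a \<Rightarrow> 'a \<Rightarrow> complex) set \<Rightarrow> ('a \<Rightarrow> 'a \<Rightarrow> complex) set"
  where "H2_scale c \<xi> = (\<lambda>\<psi> x y. c * \<psi> x y) ` \<xi> + B2"

definition H2_line :: "('a \<Rightarrow> 'a \<Rightarrow> complex) set \<Rightarrow> ('a \<Rightarrow> 'a \<Rightarrow> complex) set set"
  where "H2_line \<xi> = range (\<lambda>c. H2_scale c \<xi>)"

lemma B2I: "Vector_Spaces.linear scale (*) f \<Longrightarrow> (\<lambda>x y. f (br x y)) \<in> B2"
  unfolding B2_def mem_Collect_eq by (rule exI[of _ f]) simp

lemma B2E:
  assumes "\<psi> \<in> B2"
  obtains f where "Vector_Spaces.linear scale (*) f" "\<psi> = (\<lambda>x y. f (br x y))"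
  using assms unfolding B2_def mem_Collect_eq by (elim exE conjE)

lemma B2_zero: "(\<lambda>x y. 0) \<in> B2"
proof -
  have "Vector_Spaces.linear scale (*) (\<lambda>x. 0::complex)"
    by (simp add: Vector_Spaces.linear_iff vector_space_axioms vector_space_times)
  from B2I[OF this] show ?thesis .
qed

lemma B2_add:
  assumes "\<phi> \<in> B2" "\<psi> \<in> B2" shows "\<phi> + \<psi> \<in> B2"
proof -
  from assms obtain f g where f: "Vector_Spaces.linear scale (*) f" "\<phi> = (\<lambda>x y. f (br x y))"
    and g: "Vector_Spaces.linear scale (*) g" "\<psi> = (\<lambda>x y. g (br x y))"
    by (elim B2E)
  interpret f: Vector_Spaces.linear scale "(*)" f by fact
  interpret g: Vector_Spaces.linear scale "(*)" g by fact
  have "Vector_Spaces.linear scale (*) (\<lambda>x. f x + g x)"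
    by (simp add: Vector_Spaces.linear_iff vector_space_axioms vector_space_times
        f.add g.add f.scale g.scale distrib_left)
  from B2I[OF this] show ?thesis by (simp add: f(2) g(2) plus_fun_def)
qed

lemma B2_scale:
  assumes "\<phi> \<in> B2" shows "(\<lambda>x y. c * \<phi> x y) \<in> B2"
proof -
  from assms obtain f where f: "Vector_Spaces.linear scale (*) f" "\<phi> = (\<lambda>x y. f (br x y))"
    by (elim B2E)
  interpret f: Vector_Spaces.linear scale "(*)" f by fact
  have "Vector_Spaces.linear scale (*) (\<lambda>x. c * f x)"
    by (simp add: Vector_Spaces.linear_iff vector_space_axioms vector_space_times
        f.add f.scale distrib_left)
  from B2I[OF this] show ?thesis by (simp add: f(2))
qed

lemma B2_subset_Z2: "B2 \<subseteq> Z2"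
proof
  fix \<psi> assume "\<psi> \<in> B2"
  then obtain f where f: "Vector_Spaces.linear scale (*) f" "\<psi> = (\<lambda>x y. f (br x y))"
    by (elim B2E)
  interpret f: Vector_Spaces.linear scale "(*)" f by fact
  have bil: "bilinear_map scale (*) \<psi>"
    using bilinear_br f(1) unfolding bilinear_map_def f(2)
    by (auto simp: Vector_Spaces.linear_iff)
  have sk: "\<psi> x y = - \<psi> y x" for x y
    unfolding f(2) using skew_br[of x y] by (simp add: f.neg)
  have "\<psi> (\<alpha> x) (br y z) + \<psi> (\<alpha> y) (br z x) + \<psi> (\<alpha> z) (br x y) = 0" for x y z
  proof -
    have "\<psi> (\<alpha> x) (br y z) + \<psi> (\<alpha> y) (br z x) + \<psi> (\<alpha> z) (br x y)
        = - f (br (br x y) (\<alpha> z) + br (br y z) (\<alpha> x) + br (br z x) (\<alpha> y))"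
      unfolding sk[of "\<alpha> _"] by (simp add: f(2) f.add)
    then show ?thesis by (simp add: hom_jacobi f.zero)
  qed
  with bil sk show "\<psi> \<in> Z2" unfolding Z2_def by blast
qed

lemma H2_class_zero: "H2_class (\<lambda>x y. 0) = B2"
  unfolding H2_class_def elt_set_plus_def by (auto simp: plus_fun_def)

lemma H2_class_eq_iff: "H2_class \<phi> = H2_class \<psi> \<longleftrightarrow> \<phi> - \<psi> \<in> B2"
proof
  assume "H2_class \<phi> = H2_class \<psi>"
  moreover have "\<phi> \<in> H2_class \<phi>"
    using B2_zero unfolding H2_class_def elt_set_plus_def by (force simp: plus_fun_def)
  ultimately obtain b where "b \<in> B2" "\<phi> = \<psi> + b"
    unfolding H2_class_def elt_set_plus_def by auto
  then show "\<phi> - \<psi> \<in> B2" by simp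
next
  assume d: "\<phi> - \<psi> \<in> B2"
  then have d': "\<psi> - \<phi> \<in> B2" using B2_scale[OF d, of "-1"] by (simp add: fun_diff_def)
  have "\<phi> + b = \<psi> + (\<phi> - \<psi> + b)" "\<psi> + b = \<phi> + (\<psi> - \<phi> + b)" for b by simp_all
  then show "H2_class \<phi> = H2_class \<psi>"
    unfolding H2_class_def elt_set_plus_def using B2_add[OF d] B2_add[OF d'] by blast
qed

lemma H2_class_add: "H2_class \<phi> + H2_class \<psi> = H2_class (\<phi> + \<psi>)"
proof -
  have "B2 + B2 = B2"
    using B2_zero B2_add by (force simp: set_plus_def plus_fun_def)
  then show ?thesis unfolding H2_class_def by (simp add: set_plus_rearrange)
qed

lemma H2_class_scale: "H2_scale c (H2_class \<psi>) = H2_class (\<lambda>x y. c * \<psi> x y)"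
proof (intro equalityI subsetI)
  fix \<phi> assume "\<phi> \<in> H2_scale c (H2_class \<psi>)"
  then obtain b d where "b \<in> B2" "d \<in> B2" "\<phi> = (\<lambda>x y. c * (\<psi> + b) x y) + d"
    unfolding H2_scale_def H2_class_def elt_set_plus_def set_plus_def by blast
  then have "\<phi> = (\<lambda>x y. c * \<psi> x y) + ((\<lambda>x y. c * b x y) + d)" "(\<lambda>x y. c * b x y) + d \<in> B2"
    by (auto simp: algebra_simps plus_fun_def intro!: B2_add[unfolded plus_fun_def] B2_scale)
  then show "\<phi> \<in> H2_class (\<lambda>x y. c * \<psi> x y)"
    unfolding H2_class_def elt_set_plus_def by blast
next
  fix \<phi> assume "\<phi> \<in> H2_class (\<lambda>x y. c * \<psi> x y)"
  then obtain b where "b \<in> B2" "\<phi> = (\<lambda>x y. c * \<psi> x y) + b"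
    unfolding H2_class_def elt_set_plus_def by blast
  moreover have "\<psi> \<in> H2_class \<psi>"
    using B2_zero unfolding H2_class_def elt_set_plus_def by (force simp: plus_fun_def)
  ultimately show "\<phi> \<in> H2_scale c (H2_class \<psi>)"
    unfolding H2_scale_def set_plus_def by blast
qed

end


section \<open>The \<open>q\<close>-deformed \<open>W(2,2)\<close> algebra\<close>

definition qnum :: "complex \<Rightarrow> int \<Rightarrow> complex"
  where "qnum q n = (q powi n - q powi (-n)) / (q - inverse q)"

definition qang :: "complex \<Rightarrow> int \<Rightarrow> complex"
  where "qang q n = q powi n + q powi (-n)"

datatype windex = LI int | MI int

text \<open>
  \<open>W\<close> is the free complex vector space on \<open>windex\<close>, given as finitely supported functions.
  Its basis vectors \<open>L n\<close> and \<open>M n\<close> are the unit point masses.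
\<close>

type_synonym W = "windex \<Rightarrow>\<^sub>0 complex"

definition wscale :: "complex \<Rightarrow> W \<Rightarrow> W"
  where "wscale c x = Poly_Mapping.map (\<lambda>v. c * v) x"

abbreviation L :: "int \<Rightarrow> W" where "L n \<equiv> Poly_Mapping.single (LI n) 1"
abbreviation M :: "int \<Rightarrow> W" where "M n \<equiv> Poly_Mapping.single (MI n) 1"

definition lin_ext :: "(complex \<Rightarrow> 'b::ab_group_add \<Rightarrow> 'b) \<Rightarrow> (windex \<Rightarrow> 'b) \<Rightarrow> W \<Rightarrow> 'b"
  where "lin_ext s a x = (\<Sum>i\<in>Poly_Mapping.keys x. s (Poly_Mapping.lookup x i) (a i))"

definition bilin_ext ::
    "(complex \<Rightarrow> 'b::ab_group_add \<Rightarrow> 'b) \<Rightarrow> (windex \<Rightarrow> windex \<Rightarrow> 'b) \<Rightarrow> W \<Rightarrow> W \<Rightarrow> 'b"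
  where "bilin_ext s a x y = lin_ext s (\<lambda>i. lin_ext s (a i) y) x"

fun wbracket_basis :: "complex \<Rightarrow> windex \<Rightarrow> windex \<Rightarrow> W" where
  "wbracket_basis q (LI n) (LI m) = wscale (qnum q (m - n)) (L (m + n))"
| "wbracket_basis q (LI n) (MI m) = wscale (qnum q (m - n)) (M (m + n))"
| "wbracket_basis q (MI m) (LI n) = - wscale (qnum q (m - n)) (M (m + n))"
| "wbracket_basis q (MI n) (MI m) = 0"

definition wbracket :: "complex \<Rightarrow> W \<Rightarrow> W \<Rightarrow> W"
  where "wbracket q = bilin_ext wscale (wbracket_basis q)"

fun walpha_basis :: "complex \<Rightarrow> windex \<Rightarrow> W" where
  "walpha_basis q (LI n) = wscale (qang q n) (L n)"
| "walpha_basis q (MI n) = wscale (qang q n) (M n)"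

definition walpha :: "complex \<Rightarrow> W \<Rightarrow> W"
  where "walpha q = lin_ext wscale (walpha_basis q)"

definition cocycle_coeff :: "complex \<Rightarrow> int \<Rightarrow> int \<Rightarrow> complex"
  where "cocycle_coeff q m n =
    (if m = - n then qnum q (m - 1) * qnum q m * qnum q (m + 1) / (qnum q 2 * qnum q 3 * qang q m)
     else 0)"

fun beta_basis :: "complex \<Rightarrow> windex \<Rightarrow> windex \<Rightarrow> complex" where
  "beta_basis q (LI m) (LI n) = cocycle_coeff q m n"
| "beta_basis q _ _ = 0"

fun gamma_basis :: "complex \<Rightarrow> windex \<Rightarrow> windex \<Rightarrow> complex" where
  "gamma_basis q (LI m) (MI n) = cocycle_coeff q m n"
| "gamma_basis q (MI n) (LI m) = - cocycle_coeff q m n"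
| "gamma_basis q _ _ = 0"

definition \<beta> :: "complex \<Rightarrow> W \<Rightarrow> W \<Rightarrow> complex"
  where "\<beta> q = bilin_ext (*) (beta_basis q)"

definition \<gamma> :: "complex \<Rightarrow> W \<Rightarrow> W \<Rightarrow> complex"
  where "\<gamma> q = bilin_ext (*) (gamma_basis q)"


lemma lookup_wscale [simp]: "Poly_Mapping.lookup (wscale c x) i = c * Poly_Mapping.lookup x i"
  unfolding wscale_def by (simp add: Poly_Mapping.map.rep_eq when_def)

lemma vector_space_wscale: "vector_space wscale"
  by unfold_locales (auto intro!: poly_mapping_eqI simp: lookup_add algebra_simps)

lemma lin_ext_superset:
  assumes "vector_space s" "finite A" "Poly_Mapping.keys x \<subseteq> A"
  shows "lin_ext s a x = (\<Sum>i\<in>A. s (Poly_Mapping.lookup x i) (a i))"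
proof -
  interpret vector_space s by fact
  show ?thesis unfolding lin_ext_def using assms(2,3)
    by (intro sum.mono_neutral_left) (auto simp: in_keys_iff)
qed

lemma linear_lin_ext:
  assumes "vector_space s" shows "Vector_Spaces.linear wscale s (lin_ext s a)"
proof -
  interpret vector_space s by fact
  note sup = lin_ext_superset[OF assms]
  have add: "lin_ext s a (x + y) = lin_ext s a x + lin_ext s a y" for x y
    by (subst (1 2 3) sup[where A = "Poly_Mapping.keys x \<union> Poly_Mapping.keys y"])
      (use Poly_Mapping.keys_add[of x y] in
        \<open>auto simp: lookup_add scale_left_distrib sum.distrib\<close>)
  have scale: "lin_ext s a (wscale c x) = s c (lin_ext s a x)" for c x
    by (subst (1 2) sup[where A = "Poly_Mapping.keys x"])
      (auto simp: in_keys_iff scale_sum_right)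
  show ?thesis
    by (simp add: Vector_Spaces.linear_iff vector_space_wscale assms add scale)
qed

lemma lin_ext_single:
  assumes "vector_space s" shows "lin_ext s a (Poly_Mapping.single i 1) = a i"
proof -
  interpret vector_space s by fact
  show ?thesis by (simp add: lin_ext_def)
qed

lemma bilinear_bilin_ext:
  assumes "vector_space s" shows "bilinear_map wscale s (bilin_ext s a)"
proof -
  interpret s: vector_space s by fact
  have "Vector_Spaces.linear wscale s (\<lambda>y. lin_ext s (\<lambda>i. lin_ext s (a i) y) x)" for x
    using linear_lin_ext[OF assms] unfolding Vector_Spaces.linear_iff
    by (auto simp: lin_ext_def[of s _ x] s.scale_right_distrib sum.distrib s.scale_sum_right
        mult.commute)
  then show ?thesis
    unfolding bilinear_map_def bilin_ext_def using linear_lin_ext[OF assms] by blast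
qed

lemma bilin_ext_single:
  assumes "vector_space s"
  shows "bilin_ext s a (Poly_Mapping.single i 1) (Poly_Mapping.single j 1) = a i j"
  by (simp add: bilin_ext_def lin_ext_single[OF assms])

lemma linear_eq_lin_ext:
  assumes "Vector_Spaces.linear wscale s f"
  shows "f x = lin_ext s (\<lambda>i. f (Poly_Mapping.single i 1)) x"
proof -
  interpret Vector_Spaces.linear wscale s f by fact
  have "x = (\<Sum>i\<in>Poly_Mapping.keys x.
      wscale (Poly_Mapping.lookup x i) (Poly_Mapping.single i 1))" (is "x = ?y")
  proof (rule poly_mapping_eqI)
    fix k
    have "Poly_Mapping.lookup ?y k
        = (\<Sum>i\<in>Poly_Mapping.keys x. if i = k then Poly_Mapping.lookup x k else 0)"
      unfolding lookup_sum by (rule sum.cong) (auto simp: lookup_single when_def)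
    also have "\<dots> = Poly_Mapping.lookup x k" by (auto simp: in_keys_iff)
    finally show "Poly_Mapping.lookup x k = Poly_Mapping.lookup ?y k" by simp
  qed
  then have "f x = f ?y" by simp
  then show ?thesis by (simp add: sum scale lin_ext_def)
qed

lemma linear_eq_zeroI:
  assumes "Vector_Spaces.linear wscale s f" "\<And>i. f (Poly_Mapping.single i 1) = 0"
  shows "f x = 0"
proof -
  interpret Vector_Spaces.linear wscale s f by fact
  show ?thesis using linear_eq_lin_ext[OF assms(1), of x] by (simp add: assms(2) lin_ext_def)
qed

lemma bilin_ext_skew:
  assumes "vector_space s" "\<And>i j. a i j = - a j i"
  shows "bilin_ext s a x y = - bilin_ext s a y x"
proof -
  interpret s: vector_space s by fact
  have "Vector_Spaces.linear wscale s (\<lambda>x. bilin_ext s a x y + bilin_ext s a y x)" for y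
    using bilinear_bilin_ext[OF assms(1), of a]
    unfolding bilinear_map_def Vector_Spaces.linear_iff by (simp add: s.scale_right_distrib)
  note 1 = linear_eq_zeroI[OF this]
  have "Vector_Spaces.linear wscale s
      (\<lambda>y. bilin_ext s a (Poly_Mapping.single i 1) y + bilin_ext s a y (Poly_Mapping.single i 1))" for i
    using bilinear_bilin_ext[OF assms(1), of a]
    unfolding bilinear_map_def Vector_Spaces.linear_iff by (simp add: s.scale_right_distrib)
  note 2 = linear_eq_zeroI[OF this]
  have "bilin_ext s a x y + bilin_ext s a y x = 0"
    by (rule 1, rule 2) (metis assms(2) bilin_ext_single[OF assms(1)] add.right_inverse)
  then show ?thesis by (simp add: eq_neg_iff_add_eq_0)
qed

lemma wbracket_LM:
  "wbracket q (L n) (L m) = wscale (qnum q (m - n)) (L (m + n))"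
  "wbracket q (L n) (M m) = wscale (qnum q (m - n)) (M (m + n))"
  "wbracket q (M m) (L n) = - wscale (qnum q (m - n)) (M (m + n))"
  "wbracket q (M n) (M m) = 0"
  by (simp_all add: wbracket_def bilin_ext_single vector_space_wscale)

lemma walpha_LM:
  "walpha q (L n) = wscale (qang q n) (L n)" "walpha q (M n) = wscale (qang q n) (M n)"
  by (simp_all add: walpha_def lin_ext_single vector_space_wscale)

lemma qnum_minus: "qnum q (- n) = - qnum q n"
  by (simp add: qnum_def minus_divide_left)

lemma qnum_neg_eq: "m = - n \<Longrightarrow> qnum q m = - qnum q n"
  by (simp add: qnum_minus)

lemma cocycle_coeff_skew: "cocycle_coeff q m n = - cocycle_coeff q n m"
proof -
  have "qnum q (- n - 1) = - qnum q (n + 1)" "qnum q (- n + 1) = - qnum q (n - 1)"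
    by (rule qnum_neg_eq, simp)+
  moreover have "qang q (- n) = qang q n" by (simp add: qang_def)
  ultimately show ?thesis by (auto simp: cocycle_coeff_def qnum_minus algebra_simps)
qed

lemma bilinear_beta: "bilinear_map wscale (*) (\<beta> q)"
  and bilinear_gamma: "bilinear_map wscale (*) (\<gamma> q)"
  by (simp_all add: \<beta>_def \<gamma>_def bilinear_bilin_ext vector_space_times)

lemma skew_beta: "\<beta> q x y = - \<beta> q y x"
proof -
  have "beta_basis q i j = - beta_basis q j i" for i j
    by (cases i; cases j) (simp_all, rule cocycle_coeff_skew)
  then show ?thesis unfolding \<beta>_def by (rule bilin_ext_skew[OF vector_space_times])
qed

lemma skew_gamma: "\<gamma> q x y = - \<gamma> q y x"
proof -
  have "gamma_basis q i j = - gamma_basis q j i" for i j by (cases i; cases j) auto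
  then show ?thesis unfolding \<gamma>_def by (rule bilin_ext_skew[OF vector_space_times])
qed

lemma beta_LM:
  "\<beta> q (L m) (L n) = (if m = - n
     then qnum q (m - 1) * qnum q m * qnum q (m + 1) / (qnum q 2 * qnum q 3 * qang q m) else 0)"
  "\<beta> q (L m) (M n) = 0" "\<beta> q (M m) (M n) = 0"
  by (simp_all add: \<beta>_def bilin_ext_single vector_space_times cocycle_coeff_def)

lemma gamma_LM:
  "\<gamma> q (L m) (M n) = (if m = - n
     then qnum q (m - 1) * qnum q m * qnum q (m + 1) / (qnum q 2 * qnum q 3 * qang q m) else 0)"
  "\<gamma> q (L m) (L n) = 0" "\<gamma> q (M m) (M n) = 0"
  by (simp_all add: \<gamma>_def bilin_ext_single vector_space_times cocycle_coeff_def)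

lemma wbracket_basis_skew: "wbracket_basis q i j = - wbracket_basis q j i"
proof (cases i; cases j)
  fix n m assume ij: "i = LI n" "j = LI m"
  have "qnum q (m - n) = - qnum q (n - m)" using qnum_minus[of q "n - m"] by simp
  then show ?thesis by (auto simp: ij add.commute intro!: poly_mapping_eqI)
qed auto

lemma hom_jacobi_term:
  fixes A B C :: complex
  assumes "A \<noteq> 0" "B \<noteq> 0" "C \<noteq> 0"
  shows "(B / A - A / B) * (C / (A * B) - A * B / C) * (C + 1 / C)
    = C^2 / A^2 + 1 / A^2 - B^2 - B^2 / C^2 - C^2 / B^2 - 1 / B^2 + A^2 + A^2 / C^2"
  using assms by (simp add: field_simps power2_eq_square)

lemma qnum_hom_jacobi:
  "qnum q (b - a) * qnum q (c - a - b) * qang q c + qnum q (c - b) * qnum q (a - b - c) * qang q a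
   + qnum q (a - c) * qnum q (b - c - a) * qang q b = 0"
proof (cases "q = 0")
  case True then show ?thesis by (simp add: qnum_def)
next
  case False
  define A B C where "A = q powi a" and "B = q powi b" and "C = q powi c"
  have nz: "A \<noteq> 0" "B \<noteq> 0" "C \<noteq> 0" using False by (simp_all add: A_def B_def C_def)
  define d where "d = q - inverse q"
  have pw: "qnum q (b - a) = (B / A - A / B) / d" "qnum q (c - b) = (C / B - B / C) / d"
    "qnum q (a - c) = (A / C - C / A) / d"
    "qnum q (c - a - b) = (C / (A * B) - A * B / C) / d"
    "qnum q (a - b - c) = (A / (B * C) - B * C / A) / d"
    "qnum q (b - c - a) = (B / (C * A) - C * A / B) / d"
    "qang q c = C + 1 / C" "qang q a = A + 1 / A" "qang q b = B + 1 / B"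
    using False
    by (simp_all add: qnum_def qang_def d_def A_def B_def C_def power_int_diff power_int_add
        power_int_minus field_simps)
  have "(B / A - A / B) * (C / (A * B) - A * B / C) * (C + 1 / C)
      + (C / B - B / C) * (A / (B * C) - B * C / A) * (A + 1 / A)
      + (A / C - C / A) * (B / (C * A) - C * A / B) * (B + 1 / B) = 0"
    using hom_jacobi_term[of A B C] hom_jacobi_term[of B C A] hom_jacobi_term[of C A B] nz by simp
  then show ?thesis unfolding pw
    by (simp add: add_divide_distrib[symmetric])
qed

lemma wbracket_skew: "wbracket q x y = - wbracket q y x"
  unfolding wbracket_def by (rule bilin_ext_skew[OF vector_space_wscale wbracket_basis_skew])

lemma bilinear_wbracket: "bilinear_map wscale wscale (wbracket q)"
  unfolding wbracket_def by (rule bilinear_bilin_ext[OF vector_space_wscale])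

lemma linear_walpha: "Vector_Spaces.linear wscale wscale (walpha q)"
  unfolding walpha_def by (rule linear_lin_ext[OF vector_space_wscale])

lemma wbracket_linear:
  "wbracket q (x + x') y = wbracket q x y + wbracket q x' y"
  "wbracket q x (y + y') = wbracket q x y + wbracket q x y'"
  "wbracket q (wscale c x) y = wscale c (wbracket q x y)"
  "wbracket q x (wscale c y) = wscale c (wbracket q x y)"
  using bilinear_wbracket unfolding bilinear_map_def Vector_Spaces.linear_iff by blast+

lemma walpha_linear:
  "walpha q (x + y) = walpha q x + walpha q y" "walpha q (wscale c x) = wscale c (walpha q x)"
  using linear_walpha unfolding Vector_Spaces.linear_iff by blast+

lemma wbracket_neg: "wbracket q (- x) y = - wbracket q x y" "wbracket q 0 y = 0"
proof -
  interpret Vector_Spaces.linear wscale wscale "\<lambda>x. wbracket q x y"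
    using bilinear_wbracket unfolding bilinear_map_def by blast
  show "wbracket q (- x) y = - wbracket q x y" "wbracket q 0 y = 0" by (rule neg, rule zero)
qed

definition wjac :: "complex \<Rightarrow> W \<Rightarrow> W \<Rightarrow> W \<Rightarrow> W"
  where "wjac q x y z = wbracket q (wbracket q x y) (walpha q z)
    + wbracket q (wbracket q y z) (walpha q x) + wbracket q (wbracket q z x) (walpha q y)"

lemma wjac_cycle: "wjac q x y z = wjac q y z x"
  by (simp add: wjac_def ac_simps)

lemma wjac_linear: "Vector_Spaces.linear wscale wscale (\<lambda>x. wjac q x y z)"
proof -
  interpret vector_space wscale by (rule vector_space_wscale)
  show ?thesis
    by (simp add: Vector_Spaces.linear_iff vector_space_wscale wjac_def wbracket_linear
        walpha_linear scale_right_distrib)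
qed

lemma wscale_wscale: "wscale a (wscale b x) = wscale (a * b) x"
  by (intro poly_mapping_eqI) simp

lemma wscale_zero_eq: "c = 0 \<Longrightarrow> wscale c x = 0"
  by (intro poly_mapping_eqI) simp

lemma wscale_zero_right: "wscale c 0 = 0"
  by (intro poly_mapping_eqI) simp

lemma wscale_uminus: "- wscale a x = wscale (- a) x" "wscale a x + wscale b x = wscale (a + b) x"
  by (intro poly_mapping_eqI, simp add: lookup_add algebra_simps)+

lemma wjac_LLL: "wjac q (L a) (L b) (L c) = 0"
proof -
  have i: "c + (b + a) = a + b + c" "a + (c + b) = a + b + c" "b + (a + c) = a + b + c"
    by simp_all
  show ?thesis
    unfolding wjac_def wbracket_LM walpha_LM wbracket_linear wscale_wscale i wscale_uminus
    by (rule wscale_zero_eq) (use qnum_hom_jacobi[of q b a c] in \<open>simp add: algebra_simps\<close>)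
qed

lemma wjac_LLM: "wjac q (L a) (L b) (M c) = 0"
proof -
  have i: "c + (b + a) = a + b + c" "b + c + a = a + b + c" "a + c + b = a + b + c" "c + b + a = a + b + c"
      "c + a + b = a + b + c"
    by simp_all
  have s: "qnum q (b + c - a) = - qnum q (a - (b + c))" "qnum q (c - a) = - qnum q (a - c)"
      "qnum q (a + c - b) = - qnum q (b - (a + c))"
    by (rule qnum_neg_eq, simp)+
  show ?thesis
    unfolding wjac_def wbracket_LM walpha_LM wbracket_linear wscale_wscale i wscale_uminus
      wbracket_neg
    by (rule wscale_zero_eq)
      (use qnum_hom_jacobi[of q b a c] in \<open>simp add: s algebra_simps\<close>)
qed

lemma wjac_MM: "wjac q x (M b) (M c) = 0"
proof -
  have "wjac q (Poly_Mapping.single i 1) (M b) (M c) = 0" for i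
    by (cases i) (simp_all add: wjac_def wbracket_LM walpha_LM wbracket_linear wbracket_neg
        wscale_zero_right)
  from linear_eq_zeroI[OF wjac_linear this] show ?thesis .
qed

lemma wjac_basis:
  "wjac q (Poly_Mapping.single i 1) (Poly_Mapping.single j 1) (Poly_Mapping.single k 1) = 0"
  by (cases i; cases j; cases k; simp)
    (metis wjac_LLL wjac_LLM wjac_MM wjac_cycle)+

lemma wjac_zero: "wjac q x y z = 0"
proof -
  have 1: "wjac q x (Poly_Mapping.single j 1) (Poly_Mapping.single k 1) = 0" for x j k
    by (rule linear_eq_zeroI[OF wjac_linear]) (rule wjac_basis)
  have "wjac q y (Poly_Mapping.single k 1) x = 0" for x y k
    by (rule linear_eq_zeroI[OF wjac_linear]) (metis 1 wjac_cycle)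
  then have 2: "wjac q x y (Poly_Mapping.single k 1) = 0" for x y k
    by (metis wjac_cycle)
  have "wjac q z x y = 0"
    by (rule linear_eq_zeroI[OF wjac_linear]) (metis 2 wjac_cycle)
  then show ?thesis by (metis wjac_cycle)
qed

global_interpretation Wq: hom_lie_algebra wscale "wbracket q" "walpha q" for q
proof (intro hom_lie_algebra.intro hom_lie_algebra_axioms.intro)
  show "wbracket q (wbracket q x y) (walpha q z) + wbracket q (wbracket q y z) (walpha q x)
      + wbracket q (wbracket q z x) (walpha q y) = 0" for x y z
    using wjac_zero unfolding wjac_def .
qed (rule vector_space_wscale bilinear_wbracket linear_walpha wbracket_skew)+

end

theory Submission
  imports Defs
begin

text \<open>
  A skew-symmetric bilinear form \<open>\<psi>\<close> on \<open>W\<close> is given by three coefficient functions, namely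
  \<open>\<psi> (L a) (L b)\<close>, \<open>\<psi> (L a) (M b)\<close> and \<open>\<psi> (M a) (M b)\<close>, and the cocycle condition does not mix
  them.  Because \<open>L\<close> acts on the \<open>M\<close>'s with the same structure constants as on the \<open>L\<close>'s, the
  conditions on the first two functions are one and the same identity, \<open>hom_cocycle_id\<close>.  The
  cohomology is therefore two copies of the solution space of that identity modulo the trivial
  solutions \<open>qnum q (b - a) * f (a + b)\<close>, one copy containing \<open>\<beta>\<close> and the other \<open>\<gamma>\<close> (the solutions
  all turn out to be skew-symmetric, as the first function has to be); the third function must vanish (\<open>MM_coefficients_zero\<close>).

  The solution space modulo trivial solutions is one-dimensional
  (\<open>hom_cocycle_id_decomposition\<close>).  Writing \<open>[n]\<close> and \<open>\<langle>n\<rangle>\<close> for \<open>qnum q n\<close> and \<open>qang q n\<close>,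
  subtract a trivial solution so that \<open>\<phi> 0 n = 0\<close> for all \<open>n\<close> and \<open>\<phi> 1 (-1) = 0\<close>.  The identity
  with \<open>a = 0\<close> reads \<open>(\<langle>b\<rangle>[c] + \<langle>c\<rangle>[b]) * \<phi> b c = 2 [b + c] * \<phi> b c = 0\<close>, so \<open>\<phi>\<close> lives on the
  antidiagonal \<open>b + c = 0\<close>.  There \<open>\<phi> n (-n)\<close> is odd in \<open>n\<close>, and taking \<open>b = 1\<close> gives the
  recursion \<open>\<langle>n + 1\<rangle> [n - 1] * \<phi> (n + 1) (-n - 1) = \<langle>n\<rangle> [n + 2] * \<phi> n (-n)\<close>, so that everything
  is determined by the value at \<open>n = 2\<close> (\<open>hom_cocycle_id_rigid\<close>).  The solution of this recursion
  is \<open>cocycle_coeff\<close>, which does satisfy the identity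
  (\<open>qnum_triple_product_cyclic\<close>, \<open>hom_cocycle_id_cocycle_coeff\<close>).

  All divisions are legitimate because \<open>[n] = 0\<close> only for \<open>n = 0\<close> and \<open>\<langle>n\<rangle> \<noteq> 0\<close> when \<open>q\<close> is not a
  root of unity.  Independence of the two classes is seen at \<open>L 1\<close> and \<open>L 2\<close>: both cocycles vanish
  on the antidiagonal at \<open>1\<close>, which forces \<open>f (L 0) = f (M 0) = 0\<close> for a coboundary that equals
  \<open>s \<beta> + t \<gamma>\<close>, and the values at \<open>2\<close> then give \<open>s = t = 0\<close>.
\<close>

section \<open>Arithmetic of \<open>q\<close>-numbers\<close>

lemma qang_minus [simp]: "qang q (- n) = qang q n"
  by (simp add: qang_def)

lemma qang_0 [simp]: "qang q 0 = 2"
  by (simp add: qang_def)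

lemma qnum_0 [simp]: "qnum q 0 = 0"
  by (simp add: qnum_def)

lemma qang_qnum:
  assumes "q \<noteq> 0"
  shows "qang q m * qnum q n = qnum q (m + n) - qnum q (m - n)"
  using assms
  by (simp add: qang_def qnum_def power_int_add power_int_diff power_int_minus
      diff_divide_distrib[symmetric]) (simp add: field_simps)

text \<open>
  The factor that the cocycle identity produces when one of its indices is \<open>0\<close>; when \<open>q\<close>
  is not a root of unity, it vanishes only on the antidiagonal \<open>m + n = 0\<close>.
\<close>

lemma qang_qnum_symmetric:
  assumes "q \<noteq> 0"
  shows "qang q m * qnum q n + qang q n * qnum q m = 2 * qnum q (m + n)"
  using qang_qnum[OF assms, of m n] qang_qnum[OF assms, of n m] qnum_minus[of q "m - n"]
  by (simp add: add.commute)

lemma qnum_qnum: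
  assumes "q \<noteq> 0" "q - inverse q \<noteq> 0"
  shows "(q - inverse q)^2 * (qnum q m * qnum q n) = qang q (m + n) - qang q (m - n)"
proof -
  have "(q - inverse q)^2 * (qnum q m * qnum q n)
      = (q powi m - q powi (- m)) * (q powi n - q powi (- n))"
    using assms(2) by (simp add: qnum_def power2_eq_square)
  also have "\<dots> = qang q (m + n) - qang q (m - n)"
    using assms(1) by (simp add: qang_def power_int_add power_int_diff power_int_minus field_simps)
  finally show ?thesis .
qed

lemma power_int_eq_1_iff_not_root_of_unity:
  fixes q :: complex
  assumes "\<forall>n::nat. n > 0 \<longrightarrow> q ^ n \<noteq> 1"
  shows "q powi n = 1 \<longleftrightarrow> n = 0"
proof (cases "n \<ge> 0")
  case True
  then show ?thesis using assms[rule_format, of "nat n"] by (cases "n = 0") (auto simp: power_int_def)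
next
  case False
  then have "q ^ nat (- n) \<noteq> 1" using assms by simp
  with False show ?thesis by (simp add: power_int_def power_inverse)
qed

context
  fixes q :: complex
  assumes q_nonzero: "q \<noteq> 0"
    and not_root_of_unity: "\<forall>n::nat. n > 0 \<longrightarrow> q ^ n \<noteq> 1"
begin

lemma q_diff_inverse_nonzero: "q - inverse q \<noteq> 0"
proof
  assume "q - inverse q = 0"
  then have "q ^ 2 = 1" using q_nonzero by (simp add: field_simps power2_eq_square)
  then show False using not_root_of_unity by simp
qed

lemma qnum_eq_0_iff: "qnum q n = 0 \<longleftrightarrow> n = 0"
proof -
  have "qnum q n = 0 \<longleftrightarrow> q powi n = q powi (- n)"
    using q_diff_inverse_nonzero by (simp add: qnum_def)
  also have "\<dots> \<longleftrightarrow> q powi (n + n) = 1"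
    using q_nonzero unfolding power_int_add[OF disjI1[OF q_nonzero]]
    by (simp add: power_int_minus field_simps)
  also have "\<dots> \<longleftrightarrow> n = 0"
    by (simp add: power_int_eq_1_iff_not_root_of_unity[OF not_root_of_unity])
  finally show ?thesis .
qed

lemma qang_nonzero: "qang q n \<noteq> 0"
proof (cases "n = 0")
  case False
  then have "qang q n * qnum q n \<noteq> 0"
    using qang_qnum[OF q_nonzero, of n n] qnum_eq_0_iff[of "n + n"] by simp
  then show ?thesis by auto
qed simp

lemma qnum_1: "qnum q 1 = 1"
  using q_diff_inverse_nonzero by (simp add: qnum_def power_int_minus)

text \<open>
  Linearising the numerator of the cocycle coefficient reduces identities about it to the addition
  formulas for \<open>qnum\<close>.
\<close>

lemma qnum_triple_product:
  "(q - inverse q)^2 * (qnum q (a - 1) * qnum q a * qnum q (a + 1))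
    = qnum q (3 * a) - (1 + qang q 2) * qnum q a"
proof -
  have "(q - inverse q)^2 * (qnum q (a + 1) * qnum q (a - 1)) = qang q (2 * a) - qang q 2"
    using qnum_qnum[OF q_nonzero q_diff_inverse_nonzero, of "a + 1" "a - 1"] by simp
  then have "(q - inverse q)^2 * (qnum q (a - 1) * qnum q a * qnum q (a + 1))
      = (qang q (2 * a) - qang q 2) * qnum q a"
    by (metis mult.assoc mult.commute)
  also have "\<dots> = qnum q (3 * a) - (1 + qang q 2) * qnum q a"
    using qang_qnum[OF q_nonzero, of "2 * a" a] by (simp add: algebra_simps)
  finally show ?thesis .
qed

text \<open>
  By \<open>qnum_triple_product\<close>, the numerator is a combination of \<open>[3n]\<close> and \<open>[n]\<close>.  For each of the
  two, the product with \<open>[c - b]\<close> is a difference of two values of \<open>qang\<close>, and the cyclic sum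
  telescopes.
\<close>

lemma qnum_triple_product_cyclic:
  assumes "a + b + c = 0"
  defines "N \<equiv> \<lambda>n. qnum q (n - 1) * qnum q n * qnum q (n + 1)"
  shows "qnum q (c - b) * N a + qnum q (a - c) * N b + qnum q (b - a) * N c = 0"
proof -
  define d where "d = (q - inverse q)^2"
  define P where "P = (\<lambda>m n. d * (qnum q m * qnum q n))"
  note qq = qnum_qnum[OF q_nonzero q_diff_inverse_nonzero, folded d_def]
  have d: "d \<noteq> 0" using q_diff_inverse_nonzero by (simp add: d_def)
  have N: "d * (d * (qnum q m * N n)) = P m (3 * n) - (1 + qang q 2) * P m n" for m n
  proof -
    have "d * (d * (qnum q m * N n)) = d * (qnum q m * (d * N n))" by (simp add: ac_simps)
    then show ?thesis
      unfolding N_def qnum_triple_product[of n, folded d_def] P_def by (simp add: algebra_simps)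
  qed
  have c: "c = - a - b" using assms(1) by simp
  have P: "P m n = qang q (m + n) - qang q (m - n)" for m n by (simp add: P_def qq)
  have qang_eq: "m = n \<or> m = - n \<Longrightarrow> qang q m = qang q n" for m n by auto
  have 1: "P (c - b) a + P (a - c) b + P (b - a) c = 0"
  proof -
    have "P (c - b) a = qang q (2 * b) - qang q (2 * c)" "P (a - c) b = qang q (2 * c) - qang q (2 * a)"
      "P (b - a) c = qang q (2 * a) - qang q (2 * b)"
      unfolding P by (rule arg_cong2[where f = minus]; rule qang_eq; simp add: c)+
    then show ?thesis by simp
  qed
  have 3: "P (c - b) (3 * a) + P (a - c) (3 * b) + P (b - a) (3 * c) = 0"
  proof -
    have "P (c - b) (3 * a) = qang q (2 * (b - a)) - qang q (2 * (c - a))"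
      "P (a - c) (3 * b) = qang q (2 * (c - b)) - qang q (2 * (b - a))"
      "P (b - a) (3 * c) = qang q (2 * (c - a)) - qang q (2 * (c - b))"
      unfolding P by (rule arg_cong2[where f = minus]; rule qang_eq; simp add: c)+
    then show ?thesis by simp
  qed
  have "d * (d * (qnum q (c - b) * N a + qnum q (a - c) * N b + qnum q (b - a) * N c))
      = (P (c - b) (3 * a) + P (a - c) (3 * b) + P (b - a) (3 * c))
        - (1 + qang q 2) * (P (c - b) a + P (a - c) b + P (b - a) c)"
    unfolding distrib_left N by (simp add: algebra_simps)
  then show ?thesis using d by (simp add: 1 3)
qed

end

section \<open>The cocycle identity on coefficients\<close>

text \<open>
  The cocycle condition at \<open>L a\<close>, \<open>L b\<close>, \<open>M c\<close> for \<open>\<phi> a b = \<psi> (L a) (M b)\<close>, and equally at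
  \<open>L a\<close>, \<open>L b\<close>, \<open>L c\<close> for \<open>\<phi> a b = \<psi> (L a) (L b)\<close>.  The last term is turned round by skew symmetry so
  that an \<open>L\<close> always stands in the first argument.
\<close>

definition hom_cocycle_id :: "complex \<Rightarrow> (int \<Rightarrow> int \<Rightarrow> complex) \<Rightarrow> bool"
  where "hom_cocycle_id q \<phi> \<longleftrightarrow> (\<forall>a b c.
    qang q a * qnum q (c - b) * \<phi> a (b + c) - qang q b * qnum q (c - a) * \<phi> b (a + c)
      - qang q c * qnum q (b - a) * \<phi> (a + b) c = 0)"

lemma hom_cocycle_idD:
  "hom_cocycle_id q \<phi> \<Longrightarrow>
    qang q a * qnum q (c - b) * \<phi> a (b + c) - qang q b * qnum q (c - a) * \<phi> b (a + c)
      - qang q c * qnum q (b - a) * \<phi> (a + b) c = 0"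
  by (simp add: hom_cocycle_id_def)

lemma hom_cocycle_id_zero: "hom_cocycle_id q (\<lambda>a b. 0)"
  by (simp add: hom_cocycle_id_def)

lemma hom_cocycle_id_combination:
  assumes "hom_cocycle_id q \<phi>" "hom_cocycle_id q \<theta>" "hom_cocycle_id q \<eta>"
  shows "hom_cocycle_id q (\<lambda>a b. \<phi> a b - \<theta> a b - t * \<eta> a b)"
  unfolding hom_cocycle_id_def
proof (intro allI)
  fix a b c
  let ?E = "\<lambda>\<phi>. qang q a * qnum q (c - b) * \<phi> a (b + c)
    - qang q b * qnum q (c - a) * \<phi> b (a + c) - qang q c * qnum q (b - a) * \<phi> (a + b) c"
  have "?E (\<lambda>a b. \<phi> a b - \<theta> a b - t * \<eta> a b) = ?E \<phi> - ?E \<theta> - t * ?E \<eta>"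
    by (simp add: algebra_simps)
  also have "\<dots> = 0"
    unfolding assms[THEN hom_cocycle_idD] by simp
  finally show "?E (\<lambda>a b. \<phi> a b - \<theta> a b - t * \<eta> a b) = 0" .
qed

text \<open>
  With the common factor \<open>f (a + b + c)\<close> taken out, this is the Hom-Jacobi identity for the structure
  constants.
\<close>

lemma hom_cocycle_id_coboundary: "hom_cocycle_id q (\<lambda>a b. qnum q (b - a) * f (a + b))"
  unfolding hom_cocycle_id_def
proof (intro allI)
  fix a b c
  have s: "qnum q (b + c - a) = - qnum q (a - b - c)" "qnum q (c - a) = - qnum q (a - c)"
      "qnum q (a + c - b) = - qnum q (b - c - a)" "qnum q (c - (a + b)) = qnum q (c - a - b)"
    by (rule qnum_neg_eq, simp)+ (simp add: algebra_simps)
  have i: "a + (b + c) = a + b + c" "b + (a + c) = a + b + c" by simp_all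
  have "qang q a * qnum q (c - b) * (qnum q (b + c - a) * f (a + (b + c)))
      - qang q b * qnum q (c - a) * (qnum q (a + c - b) * f (b + (a + c)))
      - qang q c * qnum q (b - a) * (qnum q (c - (a + b)) * f (a + b + c))
    = - f (a + b + c) * (qnum q (b - a) * qnum q (c - a - b) * qang q c
      + qnum q (c - b) * qnum q (a - b - c) * qang q a
      + qnum q (a - c) * qnum q (b - c - a) * qang q b)"
    unfolding s i by (simp add: algebra_simps)
  then show "qang q a * qnum q (c - b) * (qnum q (b + c - a) * f (a + (b + c)))
      - qang q b * qnum q (c - a) * (qnum q (a + c - b) * f (b + (a + c)))
      - qang q c * qnum q (b - a) * (qnum q (c - (a + b)) * f (a + b + c)) = 0"
    by (simp add: qnum_hom_jacobi)
qed

context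
  fixes q :: complex
  assumes q_nonzero: "q \<noteq> 0"
    and not_root_of_unity: "\<forall>n::nat. n > 0 \<longrightarrow> q ^ n \<noteq> 1"
begin

lemmas qnum_zero_iff = qnum_eq_0_iff[OF q_nonzero not_root_of_unity]
lemmas qang_neq_zero = qang_nonzero[OF q_nonzero not_root_of_unity]

text \<open>
  All terms vanish unless \<open>a + b + c = 0\<close>, and in that case the factors \<open>qang\<close> cancel the denominators, which leaves
  the cyclic identity for \<open>[n - 1] [n] [n + 1]\<close>.
\<close>

lemma hom_cocycle_id_cocycle_coeff: "hom_cocycle_id q (cocycle_coeff q)"
  unfolding hom_cocycle_id_def
proof (intro allI)
  fix a b c
  let ?N = "\<lambda>n. qnum q (n - 1) * qnum q n * qnum q (n + 1)"
  let ?D = "qnum q 2 * qnum q 3"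
  show "qang q a * qnum q (c - b) * cocycle_coeff q a (b + c)
      - qang q b * qnum q (c - a) * cocycle_coeff q b (a + c)
      - qang q c * qnum q (b - a) * cocycle_coeff q (a + b) c = 0"
  proof (cases "a + b + c = 0")
    case False
    then show ?thesis by (simp add: cocycle_coeff_def)
  next
    case True
    then have i: "b + c = - a" "a + c = - b" "a + b = - c" by simp_all
    have cc: "qang q n * cocycle_coeff q n (- n) = ?N n / ?D" for n
      using qang_neq_zero[of n] by (simp add: cocycle_coeff_def)
    have ca: "qnum q (c - a) = - qnum q (a - c)" by (rule qnum_neg_eq) simp
    have "qang q a * qnum q (c - b) * cocycle_coeff q a (b + c)
        - qang q b * qnum q (c - a) * cocycle_coeff q b (a + c)
        - qang q c * qnum q (b - a) * cocycle_coeff q (a + b) c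
      = qnum q (c - b) * (qang q a * cocycle_coeff q a (- a))
        + qnum q (a - c) * (qang q b * cocycle_coeff q b (- b))
        + qnum q (b - a) * (qang q c * cocycle_coeff q c (- c))"
      unfolding i ca cocycle_coeff_skew[of q "- c" c] by (simp add: algebra_simps)
    also have "\<dots> = (qnum q (c - b) * ?N a + qnum q (a - c) * ?N b + qnum q (b - a) * ?N c) / ?D"
      unfolding cc by (simp add: add_divide_distrib)
    also have "\<dots> = 0"
      unfolding qnum_triple_product_cyclic[OF q_nonzero not_root_of_unity True] by simp
    finally show ?thesis .
  qed
qed

text \<open>
  A trivial solution vanishes at \<open>(0, 0)\<close>, so this value cannot be normalised away by subtracting
  one; it has to be derived.  For the \<open>L\<close>-\<open>L\<close> coefficients skew symmetry would give it at once, but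
  the \<open>L\<close>-\<open>M\<close> coefficients have no symmetry to start from.
\<close>

lemma hom_cocycle_id_at_0_0:
  assumes "hom_cocycle_id q \<phi>"
  shows "\<phi> 0 0 = 0"
proof -
  note id = hom_cocycle_idD[OF assms]
  \<comment> \<open>In the triple \<open>(1, -2, 1)\<close> the middle coefficient is \<open>[0]\<close>, so only \<open>\<phi> 1 (-1)\<close> and
    \<open>\<phi> (-1) 1\<close> survive; the triple \<open>(1, -1, 0)\<close> then relates their sum to \<open>\<phi> 0 0\<close>.\<close>
  have "qang q 1 * qnum q 3 * (\<phi> 1 (-1) + \<phi> (-1) 1) = 0"
    using id[where a = 1 and b = "-2" and c = 1] qnum_neg_eq[of "-3" 3 q] by (simp add: algebra_simps)
  then have odd: "\<phi> (-1) 1 = - \<phi> 1 (-1)"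
    using qang_neq_zero[of 1] qnum_zero_iff[of 3]
    by (simp add: eq_neg_iff_add_eq_0 add.commute)
  have "2 * qnum q (-2) * \<phi> 0 0 = 0"
    using id[where a = 1 and b = "-1" and c = 0] qnum_neg_eq[of "-1" 1 q] qang_minus[of q 1]
    by (simp add: odd algebra_simps)
  then show ?thesis using qnum_zero_iff[of "-2"] by simp
qed

text \<open>
  The index \<open>a = 0\<close> confines \<open>\<phi>\<close> to the antidiagonal, where the identity is a two-term recursion.
  The recursion degenerates at the step from \<open>1\<close> to \<open>2\<close>, where the leading coefficient is \<open>[0]\<close>; this
  is why the value at \<open>2\<close> is a free parameter and has to be assumed to vanish separately.
\<close>

lemma hom_cocycle_id_rigid:
  assumes id: "hom_cocycle_id q \<phi>"
    and zero: "\<And>n. n \<noteq> 0 \<Longrightarrow> \<phi> 0 n = 0"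
    and one: "\<phi> 1 (-1) = 0" and two: "\<phi> 2 (-2) = 0"
  shows "\<phi> a b = 0"
proof -
  note id' = hom_cocycle_idD[OF id]
  have \<phi>0: "\<phi> 0 n = 0" for n
    using zero hom_cocycle_id_at_0_0[OF id] by (cases "n = 0") auto
  have off: "\<phi> a b = 0" if "a + b \<noteq> 0" for a b
  proof -
    have "(qang q a * qnum q b + qang q b * qnum q a) * \<phi> a b = 0"
      using id'[where a = 0 and b = a and c = b]
      by (simp add: \<phi>0 algebra_simps neg_eq_iff_add_eq_0)
    then show ?thesis
      using that qnum_zero_iff[of "a + b"] by (simp add: qang_qnum_symmetric[OF q_nonzero])
  qed
  have odd: "\<phi> (- n) n = - \<phi> n (- n)" for n
  proof (cases "n = 0")
    case False
    have "qang q n * qnum q n * (\<phi> n (- n) + \<phi> (- n) n) = 0"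
      using id'[where a = n and b = "- n" and c = 0] qnum_minus[of q n] by (simp add: \<phi>0 algebra_simps)
    then show ?thesis
      using False qang_neq_zero[of n] qnum_zero_iff[of n]
      by (simp add: eq_neg_iff_add_eq_0 add.commute)
  qed (simp add: \<phi>0)
  have pos: "\<phi> (int n) (- int n) = 0" for n :: nat
  proof (induction n)
    case 0
    show ?case by (simp add: \<phi>0)
  next
    case (Suc n)
    show ?case
    proof (cases "n \<le> 1")
      case True
      then have "n = 0 \<or> n = 1" by auto
      then show ?thesis using one two by auto
    next
      case False
      let ?m = "int n + 1"
      have "qang q (- ?m) * qnum q (1 - int n) * \<phi> ?m (- ?m) = 0"
        using id'[where a = "int n" and b = 1 and c = "- ?m"] Suc.IH one by (simp add: algebra_simps)
      then have "\<phi> ?m (- ?m) = 0"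
        using False qang_neq_zero[of "- ?m"] qnum_zero_iff[of "1 - int n"] by simp
      then show ?thesis by (simp add: add.commute)
    qed
  qed
  have diag: "\<phi> n (- n) = 0" for n
    using pos[of "nat n"] pos[of "nat (- n)"] odd[of "- n"] by (cases "n \<ge> 0") auto
  show ?thesis
  proof (cases "a + b = 0")
    case True
    then have "b = - a" by simp
    then show ?thesis using diag by simp
  qed (rule off)
qed

lemma cocycle_coeff_values:
  "cocycle_coeff q 0 n = 0" "cocycle_coeff q 1 n = 0" "cocycle_coeff q 2 (-2) = 1 / qang q 2"
  using qnum_1[OF q_nonzero not_root_of_unity] qnum_zero_iff[of 2] qnum_zero_iff[of 3]
  by (simp_all add: cocycle_coeff_def)

text \<open>
  The function \<open>f\<close> is chosen so that the trivial solution agrees with \<open>\<phi>\<close> at \<open>(0, n)\<close> for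
  \<open>n \<noteq> 0\<close> and at \<open>(1, -1)\<close>.  Since \<open>cocycle_coeff\<close> vanishes at these places, \<open>t\<close> can be adjusted
  to match the value at \<open>(2, -2)\<close>, and rigidity applies to the difference.
\<close>

lemma hom_cocycle_id_decomposition:
  assumes "hom_cocycle_id q \<phi>"
  obtains f t where "\<And>a b. \<phi> a b = qnum q (b - a) * f (a + b) + t * cocycle_coeff q a b"
proof -
  define f where "f n = (if n = 0 then \<phi> 1 (-1) / qnum q (-2) else \<phi> 0 n / qnum q n)" for n
  define t where "t = qang q 2 * (\<phi> 2 (-2) - qnum q (-4) * f 0)"
  define \<theta> where "\<theta> a b = \<phi> a b - qnum q (b - a) * f (a + b) - t * cocycle_coeff q a b" for a b
  have "\<theta> a b = 0" for a b
  proof (rule hom_cocycle_id_rigid)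
    show "hom_cocycle_id q \<theta>"
      unfolding \<theta>_def[abs_def]
      by (intro hom_cocycle_id_combination assms hom_cocycle_id_coboundary
          hom_cocycle_id_cocycle_coeff)
    show "\<theta> 0 n = 0" if "n \<noteq> 0" for n
      using that qnum_zero_iff[of n] by (simp add: \<theta>_def f_def cocycle_coeff_values)
    show "\<theta> 1 (-1) = 0"
      using qnum_zero_iff[of "-2"] by (simp add: \<theta>_def f_def cocycle_coeff_values)
    show "\<theta> 2 (-2) = 0"
      using qang_neq_zero[of 2] by (simp add: \<theta>_def t_def cocycle_coeff_values)
  qed
  then have "\<phi> a b = qnum q (b - a) * f (a + b) + t * cocycle_coeff q a b" for a b
    unfolding \<theta>_def by (simp add: algebra_simps)
  then show thesis by (rule that)
qed

text \<open>
  The cocycle condition at \<open>L a\<close>, \<open>M b\<close>, \<open>M c\<close> has two terms only, since \<open>[M b, M c] = 0\<close>.  Off the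
  antidiagonal \<open>a = 0\<close> suffices as before; on it, putting one of the \<open>M\<close>-indices to \<open>0\<close> leaves a
  single term.
\<close>

lemma MM_coefficients_zero:
  assumes skew: "\<And>a b. \<chi> a b = - \<chi> b a"
    and id: "\<And>a b c. qang q c * qnum q (b - a) * \<chi> c (a + b)
      = qang q b * qnum q (c - a) * \<chi> b (a + c)"
  shows "\<chi> a b = (0 :: complex)"
proof -
  have \<chi>0: "\<chi> 0 0 = 0" using skew[of 0 0] by (simp add: eq_neg_iff_add_eq_0)
  show ?thesis
  proof (cases "a + b = 0")
    case False
    have "qang q b * qnum q a * \<chi> b a = qang q a * qnum q b * \<chi> a b"
      using id[where a = 0 and b = a and c = b] by simp
    then have "(qang q a * qnum q b + qang q b * qnum q a) * \<chi> a b = 0"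
      unfolding skew[of b a] by (simp add: algebra_simps neg_eq_iff_add_eq_0)
    then show ?thesis
      using False qnum_zero_iff[of "a + b"] by (simp add: qang_qnum_symmetric[OF q_nonzero])
  next
    case True
    then have b: "b = - a" by simp
    show ?thesis
    proof (cases "a = 0")
      case False
      have "qang q a * qnum q a * \<chi> a (- a) = 0"
        using id[where a = "- a" and b = 0 and c = a] by (simp add: \<chi>0)
      then show ?thesis using False qang_neq_zero[of a] qnum_zero_iff[of a] by (simp add: b)
    qed (simp add: b \<chi>0)
  qed
qed

end

section \<open>From coefficients to bilinear maps\<close>

lemma bilinear_map_rules:
  assumes "bilinear_map wscale (*) \<psi>"
  shows "\<psi> (wscale c x) y = c * \<psi> x y" "\<psi> x (wscale c y) = c * \<psi> x y"
    "\<psi> (x + x') y = \<psi> x y + \<psi> x' y" "\<psi> x (y + y') = \<psi> x y + \<psi> x y'"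
    "\<psi> x (- y) = - \<psi> x y" "\<psi> x 0 = 0"
proof -
  interpret r: Vector_Spaces.linear wscale "(*)" "\<psi> x" for x
    using assms unfolding bilinear_map_def by blast
  interpret l: Vector_Spaces.linear wscale "(*)" "\<lambda>x. \<psi> x y" for y
    using assms unfolding bilinear_map_def by blast
  show "\<psi> (wscale c x) y = c * \<psi> x y" "\<psi> x (wscale c y) = c * \<psi> x y"
    "\<psi> (x + x') y = \<psi> x y + \<psi> x' y" "\<psi> x (y + y') = \<psi> x y + \<psi> x y'"
    "\<psi> x (- y) = - \<psi> x y" "\<psi> x 0 = 0"
    by (fact l.scale r.scale l.add r.add r.neg r.zero)+
qed

lemma bilinear_map_eqI:
  assumes bil: "bilinear_map wscale (*) \<phi>" "bilinear_map wscale (*) \<psi>"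
    and eq: "\<And>i j. \<phi> (Poly_Mapping.single i 1) (Poly_Mapping.single j 1)
      = \<psi> (Poly_Mapping.single i 1) (Poly_Mapping.single j 1)"
  shows "\<phi> = \<psi>"
proof (intro ext)
  fix x y
  note rules = bil[THEN bilinear_map_rules(1)] bil[THEN bilinear_map_rules(2)]
    bil[THEN bilinear_map_rules(3)] bil[THEN bilinear_map_rules(4)]
  have l: "Vector_Spaces.linear wscale (*) (\<lambda>x. \<phi> x y - \<psi> x y)" for y
    by (simp add: Vector_Spaces.linear_iff vector_space_wscale vector_space_times rules
        algebra_simps)
  have r: "Vector_Spaces.linear wscale (*) (\<lambda>y. \<phi> x y - \<psi> x y)" for x
    by (simp add: Vector_Spaces.linear_iff vector_space_wscale vector_space_times rules
        algebra_simps)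
  have "\<phi> x y - \<psi> x y = 0"
    by (rule linear_eq_zeroI[OF l], rule linear_eq_zeroI[OF r]) (simp add: eq)
  then show "\<phi> x y = \<psi> x y" by simp
qed

text \<open>
  Cyclic symmetry makes linearity in the first argument enough: each argument can be rotated there
  and replaced by basis vectors.
\<close>

lemma cyclic_trilinear_eq_zeroI:
  fixes J :: "W \<Rightarrow> W \<Rightarrow> W \<Rightarrow> complex"
  assumes lin: "\<And>y z. Vector_Spaces.linear wscale (*) (\<lambda>x. J x y z)"
    and cyc: "\<And>x y z. J x y z = J y z x"
    and basis: "\<And>i j k. J (Poly_Mapping.single i 1) (Poly_Mapping.single j 1)
      (Poly_Mapping.single k 1) = 0"
  shows "J x y z = 0"
proof -
  have 1: "J x (Poly_Mapping.single j 1) (Poly_Mapping.single k 1) = 0" for x j k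
    by (rule linear_eq_zeroI[OF lin]) (rule basis)
  have 2: "J y (Poly_Mapping.single k 1) x = 0" for x y k
    by (rule linear_eq_zeroI[OF lin]) (subst cyc, subst cyc, rule 1)
  have "J z x y = 0"
    by (rule linear_eq_zeroI[OF lin]) (subst cyc, subst cyc, rule 2)
  then show ?thesis using cyc[of z x y] by simp
qed

lemma Z2D:
  assumes "\<psi> \<in> Wq.Z2 q"
  shows "bilinear_map wscale (*) \<psi>" "\<psi> x y = - \<psi> y x"
    "\<psi> (walpha q x) (wbracket q y z) + \<psi> (walpha q y) (wbracket q z x)
      + \<psi> (walpha q z) (wbracket q x y) = 0"
proof -
  have *: "bilinear_map wscale (*) \<psi> \<and> (\<forall>x y. \<psi> x y = - \<psi> y x) \<and>
    (\<forall>x y z. \<psi> (walpha q x) (wbracket q y z) + \<psi> (walpha q y) (wbracket q z x)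
      + \<psi> (walpha q z) (wbracket q x y) = 0)"
    using assms unfolding Wq.Z2_def mem_Collect_eq .
  show "bilinear_map wscale (*) \<psi>" by (rule conjunct1[OF *])
  show "\<psi> x y = - \<psi> y x" by (rule conjunct1[OF conjunct2[OF *], rule_format])
  show "\<psi> (walpha q x) (wbracket q y z) + \<psi> (walpha q y) (wbracket q z x)
      + \<psi> (walpha q z) (wbracket q x y) = 0"
    by (rule conjunct2[OF conjunct2[OF *], rule_format])
qed

lemma Z2I:
  assumes "bilinear_map wscale (*) \<psi>" "\<And>x y. \<psi> x y = - \<psi> y x"
    and "\<And>x y z. \<psi> (walpha q x) (wbracket q y z) + \<psi> (walpha q y) (wbracket q z x)
      + \<psi> (walpha q z) (wbracket q x y) = 0"
  shows "\<psi> \<in> Wq.Z2 q"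
  unfolding Wq.Z2_def mem_Collect_eq by (intro conjI allI; fact assms)

lemma Z2I_basis:
  assumes bil: "bilinear_map wscale (*) \<psi>" and skew: "\<And>x y. \<psi> x y = - \<psi> y x"
    and LL: "hom_cocycle_id q (\<lambda>a b. \<psi> (L a) (L b))"
    and LM: "hom_cocycle_id q (\<lambda>a b. \<psi> (L a) (M b))"
    and MM: "\<And>a b. \<psi> (M a) (M b) = 0"
  shows "\<psi> \<in> Wq.Z2 q"
proof -
  define J where "J x y z = \<psi> (walpha q x) (wbracket q y z) + \<psi> (walpha q y) (wbracket q z x)
      + \<psi> (walpha q z) (wbracket q x y)" for x y z
  note rules = bilinear_map_rules[OF bil]
  note eval = J_def walpha_LM wbracket_LM rules
  have cyc: "J x y z = J y z x" for x y z by (simp add: J_def)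
  have lin: "Vector_Spaces.linear wscale (*) (\<lambda>x. J x y z)" for y z
    by (simp add: Vector_Spaces.linear_iff vector_space_wscale vector_space_times J_def
        walpha_linear wbracket_linear rules algebra_simps)
  have LLL: "J (L a) (L b) (L c) = 0" for a b c
    using hom_cocycle_idD[OF LL, where a = a and b = b and c = c] qnum_neg_eq[of "a - c" "c - a" q]
      skew[of "L c" "L (a + b)"]
    by (simp add: eval algebra_simps)
  have LLM: "J (L a) (L b) (M c) = 0" for a b c
    using hom_cocycle_idD[OF LM, where a = a and b = b and c = c] skew[of "M c" "L (a + b)"]
    by (simp add: eval algebra_simps)
  have LMM: "J (L a) (M b) (M c) = 0" and MMM: "J (M a) (M b) (M c) = 0" for a b c
    by (simp_all add: eval MM)
  have "J (Poly_Mapping.single i 1) (Poly_Mapping.single j 1) (Poly_Mapping.single k 1) = 0"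
    for i j k
    by (cases i; cases j; cases k; simp) (metis LLL LLM LMM MMM cyc)+
  then have "J x y z = 0" for x y z by (rule cyclic_trilinear_eq_zeroI[OF lin cyc])
  then show ?thesis unfolding J_def by (rule Z2I[OF bil skew])
qed

lemma Z2_imp_hom_cocycle_id:
  assumes "\<psi> \<in> Wq.Z2 q"
  shows "hom_cocycle_id q (\<lambda>a b. \<psi> (L a) (L b))" "hom_cocycle_id q (\<lambda>a b. \<psi> (L a) (M b))"
proof -
  note rules = walpha_LM wbracket_LM bilinear_map_rules[OF Z2D(1)[OF assms]]
  note skew = Z2D(2)[OF assms] and coc = Z2D(3)[OF assms]
  show "hom_cocycle_id q (\<lambda>a b. \<psi> (L a) (L b))"
    unfolding hom_cocycle_id_def
  proof (intro allI)
    fix a b c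
    show "qang q a * qnum q (c - b) * \<psi> (L a) (L (b + c))
        - qang q b * qnum q (c - a) * \<psi> (L b) (L (a + c))
        - qang q c * qnum q (b - a) * \<psi> (L (a + b)) (L c) = 0"
      using coc[of "L a" "L b" "L c"] qnum_neg_eq[of "a - c" "c - a" q]
        skew[of "L c" "L (a + b)"]
      by (simp add: rules algebra_simps)
  qed
  show "hom_cocycle_id q (\<lambda>a b. \<psi> (L a) (M b))"
    unfolding hom_cocycle_id_def
  proof (intro allI)
    fix a b c
    show "qang q a * qnum q (c - b) * \<psi> (L a) (M (b + c))
        - qang q b * qnum q (c - a) * \<psi> (L b) (M (a + c))
        - qang q c * qnum q (b - a) * \<psi> (L (a + b)) (M c) = 0"
      using coc[of "L a" "L b" "M c"] skew[of "M c" "L (a + b)"]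
      by (simp add: rules algebra_simps)
  qed
qed

lemma combination_in_Z2:
  assumes "\<phi> \<in> Wq.Z2 q" "\<psi> \<in> Wq.Z2 q"
  shows "(\<lambda>x y. s * \<phi> x y + t * \<psi> x y) \<in> Wq.Z2 q"
proof -
  note rules = bilinear_map_rules(1-4)[OF Z2D(1)[OF assms(1)]]
    bilinear_map_rules(1-4)[OF Z2D(1)[OF assms(2)]]
  let ?\<rho> = "\<lambda>x y. s * \<phi> x y + t * \<psi> x y"
  show ?thesis
  proof (rule Z2I)
    show "bilinear_map wscale (*) ?\<rho>"
      unfolding bilinear_map_def Vector_Spaces.linear_iff
      by (intro conjI allI vector_space_wscale vector_space_times)
        (simp_all only: rules, simp_all add: algebra_simps)
    show "?\<rho> x y = - ?\<rho> y x" for x y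
      unfolding Z2D(2)[OF assms(1), of x y] Z2D(2)[OF assms(2), of x y] by simp
    show "?\<rho> (walpha q x) (wbracket q y z) + ?\<rho> (walpha q y) (wbracket q z x)
        + ?\<rho> (walpha q z) (wbracket q x y) = 0" for x y z
    proof -
      let ?J = "\<lambda>\<psi>. \<psi> (walpha q x) (wbracket q y z) + \<psi> (walpha q y) (wbracket q z x)
        + \<psi> (walpha q z) (wbracket q x y)"
      have "?J ?\<rho> = s * ?J \<phi> + t * ?J \<psi>" by (simp add: algebra_simps)
      then show ?thesis unfolding assms[THEN Z2D(3)] by simp
    qed
  qed
qed

section \<open>The second cohomology\<close>

lemma beta_in_Z2:
  assumes "q \<noteq> 0" "\<forall>n::nat. n > 0 \<longrightarrow> q ^ n \<noteq> 1"
  shows "\<beta> q \<in> Wq.Z2 q"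
  by (rule Z2I_basis[OF bilinear_beta skew_beta])
    (simp_all add: beta_LM(2,3) hom_cocycle_id_zero
      hom_cocycle_id_cocycle_coeff[OF assms] beta_LM(1)[folded cocycle_coeff_def])

lemma gamma_in_Z2:
  assumes "q \<noteq> 0" "\<forall>n::nat. n > 0 \<longrightarrow> q ^ n \<noteq> 1"
  shows "\<gamma> q \<in> Wq.Z2 q"
  by (rule Z2I_basis[OF bilinear_gamma skew_gamma])
    (simp_all add: gamma_LM(2,3) hom_cocycle_id_zero
      hom_cocycle_id_cocycle_coeff[OF assms] gamma_LM(1)[folded cocycle_coeff_def])

lemma beta_gamma_independent:
  assumes "q \<noteq> 0" "\<forall>n::nat. n > 0 \<longrightarrow> q ^ n \<noteq> 1"
    and "(\<lambda>x y. s * \<beta> q x y + t * \<gamma> q x y) \<in> Wq.B2 q"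
  shows "s = 0 \<and> t = 0"
proof -
  from assms(3) obtain f where f: "Vector_Spaces.linear wscale (*) f"
    and eq: "(\<lambda>x y. s * \<beta> q x y + t * \<gamma> q x y) = (\<lambda>x y. f (wbracket q x y))"
    by (rule Wq.B2E)
  interpret f: Vector_Spaces.linear wscale "(*)" f by fact
  note eq' = fun_cong[OF fun_cong[OF eq]]
  note coeffs = cocycle_coeff_values[OF assms(1,2)]
  note basis = beta_LM(2,3) gamma_LM(2,3) beta_LM(1)[folded cocycle_coeff_def]
    gamma_LM(1)[folded cocycle_coeff_def] wbracket_LM f.scale coeffs
  have "f (L 0) = 0" "f (M 0) = 0"
    using eq'[of "L 1" "L (-1)"] eq'[of "L 1" "M (-1)"] qnum_eq_0_iff[OF assms(1,2), of "-2"]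
    by (simp_all add: basis)
  then show ?thesis
    using eq'[of "L 2" "L (-2)"] eq'[of "L 2" "M (-2)"] qang_nonzero[OF assms(1,2), of 2]
    by (simp add: basis)
qed

text \<open>
  The decompositions of the \<open>L\<close>-\<open>L\<close> and \<open>L\<close>-\<open>M\<close> coefficients supply the two scalars, and their two
  trivial parts are the values of one linear functional on the \<open>L n\<close> and on the \<open>M n\<close>.
\<close>

lemma Z2_decomposition:
  assumes "q \<noteq> 0" "\<forall>n::nat. n > 0 \<longrightarrow> q ^ n \<noteq> 1" "\<psi> \<in> Wq.Z2 q"
  obtains s t where "\<psi> - (\<lambda>x y. s * \<beta> q x y + t * \<gamma> q x y) \<in> Wq.B2 q"
proof -
  note bil = Z2D(1)[OF assms(3)] and skew = Z2D(2)[OF assms(3)] and coc = Z2D(3)[OF assms(3)]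
  note rules = bilinear_map_rules[OF bil]
  obtain f s where LL: "\<And>a b. \<psi> (L a) (L b) = qnum q (b - a) * f (a + b) + s * cocycle_coeff q a b"
    by - (rule hom_cocycle_id_decomposition[OF assms(1,2) Z2_imp_hom_cocycle_id(1)[OF assms(3)]]; rule that)
  obtain g t where LM: "\<And>a b. \<psi> (L a) (M b) = qnum q (b - a) * g (a + b) + t * cocycle_coeff q a b"
    by - (rule hom_cocycle_id_decomposition[OF assms(1,2) Z2_imp_hom_cocycle_id(2)[OF assms(3)]]; rule that)
  have MM: "\<psi> (M a) (M b) = 0" for a b
  proof (rule MM_coefficients_zero[OF assms(1,2), where \<chi> = "\<lambda>a b. \<psi> (M a) (M b)"])
    show "qang q c * qnum q (b - a) * \<psi> (M c) (M (a + b))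
        = qang q b * qnum q (c - a) * \<psi> (M b) (M (a + c))" for a b c
      using coc[of "L a" "M b" "M c"] by (simp add: walpha_LM wbracket_LM rules algebra_simps)
  qed (rule skew)
  define F where "F = lin_ext (*) (case_windex f g)"
  have F: "Vector_Spaces.linear wscale (*) F"
    unfolding F_def by (rule linear_lin_ext[OF vector_space_times])
  interpret F: Vector_Spaces.linear wscale "(*)" F by fact
  have F_basis: "F (L n) = f n" "F (M n) = g n" for n
    by (simp_all add: F_def lin_ext_single[OF vector_space_times])
  let ?\<rho> = "\<lambda>x y. s * \<beta> q x y + t * \<gamma> q x y + F (wbracket q x y)"
  have cob: "(\<lambda>x y. F (wbracket q x y)) \<in> Wq.Z2 q"
    by (rule subsetD[OF Wq.B2_subset_Z2 Wq.B2I[OF F]])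
  have "(\<lambda>x y. s * \<beta> q x y + t * \<gamma> q x y) \<in> Wq.Z2 q"
    by (rule combination_in_Z2[OF beta_in_Z2[OF assms(1,2)] gamma_in_Z2[OF assms(1,2)]])
  from combination_in_Z2[OF this cob, where s = 1 and t = 1]
  have \<rho>: "?\<rho> \<in> Wq.Z2 q" by simp
  note basis = beta_LM(2,3) gamma_LM(2,3) beta_LM(1)[folded cocycle_coeff_def]
    gamma_LM(1)[folded cocycle_coeff_def] wbracket_LM F.scale F.zero F_basis
  have eqLL: "\<psi> (L a) (L b) = ?\<rho> (L a) (L b)" and eqLM: "\<psi> (L a) (M b) = ?\<rho> (L a) (M b)"
    and eqMM: "\<psi> (M a) (M b) = ?\<rho> (M a) (M b)" for a b
    by (simp_all add: basis LL LM MM add.commute)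
  have eqML: "\<psi> (M a) (L b) = ?\<rho> (M a) (L b)" for a b
    using skew[of "M a" "L b"] Z2D(2)[OF \<rho>, of "M a" "L b"] eqLM[of b a] by (simp only:)
  have "\<psi> = ?\<rho>"
  proof (rule bilinear_map_eqI[OF bil Z2D(1)[OF \<rho>]])
    fix i j
    show "\<psi> (Poly_Mapping.single i 1) (Poly_Mapping.single j 1)
      = ?\<rho> (Poly_Mapping.single i 1) (Poly_Mapping.single j 1)"
      by (cases i; cases j; hypsubst) (rule eqLL eqLM eqML eqMM)+
  qed
  then have "\<psi> - (\<lambda>x y. s * \<beta> q x y + t * \<gamma> q x y) = (\<lambda>x y. F (wbracket q x y))"
    by (simp add: fun_eq_iff)
  then have "\<psi> - (\<lambda>x y. s * \<beta> q x y + t * \<gamma> q x y) \<in> Wq.B2 q"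
    using Wq.B2I[OF F] by simp
  then show thesis by (rule that)
qed

lemma H2_line_sum:
  "\<xi> \<in> Wq.H2_line q (Wq.H2_class q \<phi>) + Wq.H2_line q (Wq.H2_class q \<psi>)
    \<longleftrightarrow> (\<exists>s t. \<xi> = Wq.H2_class q (\<lambda>x y. s * \<phi> x y + t * \<psi> x y))"
  unfolding set_plus_def[of "Wq.H2_line q (Wq.H2_class q \<phi>)"]
  unfolding Wq.H2_line_def Wq.H2_class_scale
  by (auto simp: Wq.H2_class_add plus_fun_def)

theorem proposition2p5:
  fixes q :: complex
  assumes "q \<noteq> 0" and "\<forall>n::nat. n > 0 \<longrightarrow> q ^ n \<noteq> 1"
  shows "\<beta> q \<in> Wq.Z2 q \<and> \<gamma> q \<in> Wq.Z2 q
    \<and> Wq.H2_class q (\<beta> q) \<noteq> Wq.B2 q \<and> Wq.H2_class q (\<gamma> q) \<noteq> Wq.B2 q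
    \<and> Wq.H2 q = Wq.H2_line q (Wq.H2_class q (\<beta> q)) + Wq.H2_line q (Wq.H2_class q (\<gamma> q))
    \<and> Wq.H2_line q (Wq.H2_class q (\<beta> q)) \<inter> Wq.H2_line q (Wq.H2_class q (\<gamma> q)) = {Wq.B2 q}"
proof (intro conjI)
  note beta = beta_in_Z2[OF assms] and gamma = gamma_in_Z2[OF assms]
  note indep = beta_gamma_independent[OF assms]
  show "\<beta> q \<in> Wq.Z2 q" "\<gamma> q \<in> Wq.Z2 q" by (fact beta gamma)+
  show "Wq.H2_class q (\<beta> q) \<noteq> Wq.B2 q"
    using indep[of 1 0] Wq.H2_class_eq_iff[of q "\<beta> q" "\<lambda>x y. 0"]
    by (auto simp: Wq.H2_class_zero fun_diff_def)
  show "Wq.H2_class q (\<gamma> q) \<noteq> Wq.B2 q"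
    using indep[of 0 1] Wq.H2_class_eq_iff[of q "\<gamma> q" "\<lambda>x y. 0"]
    by (auto simp: Wq.H2_class_zero fun_diff_def)
  show "Wq.H2 q = Wq.H2_line q (Wq.H2_class q (\<beta> q)) + Wq.H2_line q (Wq.H2_class q (\<gamma> q))"
  proof (intro equalityI subsetI)
    fix \<xi> assume "\<xi> \<in> Wq.H2 q"
    then obtain \<psi> where \<psi>: "\<psi> \<in> Wq.Z2 q" "\<xi> = Wq.H2_class q \<psi>"
      unfolding Wq.H2_def by blast
    obtain s t where "\<psi> - (\<lambda>x y. s * \<beta> q x y + t * \<gamma> q x y) \<in> Wq.B2 q"
      using Z2_decomposition[OF assms \<psi>(1)] .
    then have "\<xi> = Wq.H2_class q (\<lambda>x y. s * \<beta> q x y + t * \<gamma> q x y)"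
      unfolding \<psi>(2) Wq.H2_class_eq_iff .
    then show "\<xi> \<in> Wq.H2_line q (Wq.H2_class q (\<beta> q)) + Wq.H2_line q (Wq.H2_class q (\<gamma> q))"
      unfolding H2_line_sum by blast
  next
    fix \<xi> assume "\<xi> \<in> Wq.H2_line q (Wq.H2_class q (\<beta> q)) + Wq.H2_line q (Wq.H2_class q (\<gamma> q))"
    then show "\<xi> \<in> Wq.H2 q"
      unfolding H2_line_sum Wq.H2_def using combination_in_Z2[OF beta gamma] by blast
  qed
  show "Wq.H2_line q (Wq.H2_class q (\<beta> q)) \<inter> Wq.H2_line q (Wq.H2_class q (\<gamma> q)) = {Wq.B2 q}"
  proof (intro equalityI subsetI)
    fix \<xi> assume "\<xi> \<in> Wq.H2_line q (Wq.H2_class q (\<beta> q)) \<inter> Wq.H2_line q (Wq.H2_class q (\<gamma> q))"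
    then obtain s t where s: "\<xi> = Wq.H2_class q (\<lambda>x y. s * \<beta> q x y)"
      and t: "\<xi> = Wq.H2_class q (\<lambda>x y. t * \<gamma> q x y)"
      unfolding Wq.H2_line_def Wq.H2_class_scale by blast
    then have "(\<lambda>x y. s * \<beta> q x y) - (\<lambda>x y. t * \<gamma> q x y) \<in> Wq.B2 q"
      by (simp add: Wq.H2_class_eq_iff[symmetric])
    then have "s = 0" using indep[of s "- t"] by (simp add: fun_diff_def)
    then show "\<xi> \<in> {Wq.B2 q}" unfolding s by (simp add: Wq.H2_class_zero)
  next
    fix \<xi> assume "\<xi> \<in> {Wq.B2 q}"
    then have "\<xi> = Wq.H2_scale q 0 (Wq.H2_class q \<phi>)" for \<phi>
      by (simp add: Wq.H2_class_scale Wq.H2_class_zero)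
    then show "\<xi> \<in> Wq.H2_line q (Wq.H2_class q (\<beta> q)) \<inter> Wq.H2_line q (Wq.H2_class q (\<gamma> q))"
      unfolding Wq.H2_line_def by blast
  qed
qed

end
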